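(* Let $a_0,a_1,a_2,a_3\in\mathbb{R}$ with $a_3\neq0$. The cubic polynomial $c(x)=a_3x^3+3a_2x^2+3a_1x+a_0$ has three real roots if and only if the quadratic element $A_2=a_2^2-a_1a_3$ is non-negative and the coefficient $a_0$ lies in the interval $[a^{(0)}_2,a^{(0)}_1]$, where $$a^{(0)}_{1}=\frac{-3a_2A_2+a_2^3+2A_2^{3/2}}{a_3^2},\qquad a^{(0)}_{2}=\frac{-3a_2A_2+a_2^3-2A_2^{3/2}}{a_3^2}.$$
   Context: Roots are counted with multiplicity: "three real roots" means that all three roots of $c$ in $\mathbb{C}$ are real, not necessarily distinct. *)

theory Defs
  imports Complex_Main "HOL-Computational_Algebra.Computational_Algebra"
begin

definition cubic :: "real \<Rightarrow> real \<Rightarrow> real \<Rightarrow> real \<Rightarrow> real poly" where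
  "cubic a0 a1 a2 a3 = [:a0, 3 * a1, 3 * a2, a3:]"

definition quadratic_element :: "real \<Rightarrow> real \<Rightarrow> real \<Rightarrow> real" where
  "quadratic_element a1 a2 a3 = a2^2 - a1 * a3"

(* The complex roots, counted with multiplicity, are three in number and all real;
   they need not be distinct. *)
definition three_real_roots :: "real poly \<Rightarrow> bool" where
  "three_real_roots p \<longleftrightarrow>
     size (proots (map_poly complex_of_real p)) = 3 \<and>
     (\<forall>z \<in># proots (map_poly complex_of_real p). z \<in> \<real>)"

(* If the quadratic element is negative, the value of powr, and hence of the two
   endpoints below, is a meaningless convention. *)
definition a0_upper :: "real \<Rightarrow> real \<Rightarrow> real \<Rightarrow> real" where
  "a0_upper a1 a2 a3 =
     (- 3 * a2 * quadratic_element a1 a2 a3 + a2^3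
        + 2 * quadratic_element a1 a2 a3 powr (3/2)) / a3^2"

definition a0_lower :: "real \<Rightarrow> real \<Rightarrow> real \<Rightarrow> real" where
  "a0_lower a1 a2 a3 =
     (- 3 * a2 * quadratic_element a1 a2 a3 + a2^3
        - 2 * quadratic_element a1 a2 a3 powr (3/2)) / a3^2"

end

theory Submission
  imports Defs
begin

text \<open>
  Substituting \<open>t = a\<^sub>3 x + a\<^sub>2\<close> turns \<open>a\<^sub>3\<^sup>2 c(x)\<close> into \<open>t\<^sup>3 - 3 A\<^sub>2 t + q\<close> with
  \<open>q = a\<^sub>0 a\<^sub>3\<^sup>2 + 3 a\<^sub>2 A\<^sub>2 - a\<^sub>2\<^sup>3\<close>, and the interval condition on \<open>a\<^sub>0\<close> says
  \<open>\<bar>q\<bar> \<le> 2 A\<^sub>2\<^bsup>3/2\<^esup>\<close>. If the roots are real, then \<open>27 (4 A\<^sub>2\<^sup>3 - q\<^sup>2)\<close> is the discriminant,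
  a square. Conversely, the bound makes the depressed cubic change sign
  on \<open>[-2 \<surd>A\<^sub>2, 2 \<surd>A\<^sub>2]\<close>, and splitting off a root \<open>t\<close> from this interval leaves a quadratic
  of discriminant \<open>3 (4 A\<^sub>2 - t\<^sup>2) \<ge> 0\<close>.
\<close>

text \<open>Over the complex numbers a polynomial is its leading coefficient times the product of
  the linear factors given by \<open>proots\<close>. If these roots are real, both sides are images
  of real polynomials, and injectivity of the embedding on coefficients brings the factorization
  down to the reals.\<close>

lemma three_real_roots_iff:
  fixes p :: "real poly"
  assumes "degree p = 3"
  shows "three_real_roots p \<longleftrightarrow>
    (\<exists>x y z. p = smult (lead_coeff p) ([:-x, 1:] * [:-y, 1:] * [:-z, 1:]))"
proof -
  let ?c = "map_poly complex_of_real"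
  have split: "?c (smult k ([:-x, 1:] * [:-y, 1:] * [:-z, 1:])) =
      smult (of_real k) ([:- complex_of_real x, 1:] * [:- of_real y, 1:] * [:- of_real z, 1:])"
    for k x y z
    by (simp add: map_poly_smult map_poly_pCons algebra_simps)
  have "p \<noteq> 0" using assms by auto
  show ?thesis
  proof
    assume real: "three_real_roots p"
    obtain xs where xs: "mset xs = proots (?c p)"
      using ex_mset by blast
    have "length xs = Suc (Suc (Suc 0))"
      using real unfolding three_real_roots_def xs[symmetric] by simp
    then obtain u v w where "xs = [u, v, w]"
      by (auto simp: length_Suc_conv)
    with xs have uvw: "proots (?c p) = {#u, v, w#}" by simp
    with real obtain x y z where xyz: "u = of_real x" "v = of_real y" "w = of_real z"
      unfolding three_real_roots_def by (auto simp: Reals_def)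
    have "?c p = smult (lead_coeff (?c p)) (\<Prod>x\<in>#proots (?c p). [:-x, 1:])"
      by (simp add: complex_poly_decompose_multiset)
    also have "\<dots> = ?c (smult (lead_coeff p) ([:-x, 1:] * [:-y, 1:] * [:-z, 1:]))"
      unfolding split uvw by (simp add: xyz coeff_map_poly degree_map_poly algebra_simps)
    finally show "\<exists>x y z. p = smult (lead_coeff p) ([:-x, 1:] * [:-y, 1:] * [:-z, 1:])"
      by (metis (no_types, lifting) coeff_map_poly of_real_0 of_real_eq_iff poly_eqI)
  next
    assume "\<exists>x y z. p = smult (lead_coeff p) ([:-x, 1:] * [:-y, 1:] * [:-z, 1:])"
    then obtain x y z where p: "p = smult (lead_coeff p) ([:-x, 1:] * [:-y, 1:] * [:-z, 1:])"
      by blast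
    have "proots (?c p) = {#of_real x, of_real y, of_real z#}"
      using \<open>p \<noteq> 0\<close> by (subst p, subst split) (simp add: proots_mult del: mult_pCons_left mult_pCons_right)
    then show "three_real_roots p"
      by (simp add: three_real_roots_def)
  qed
qed

lemma cubic_splits_iff:
  "cubic a0 a1 a2 a3 = smult a3 ([:-x, 1:] * [:-y, 1:] * [:-z, 1:]) \<longleftrightarrow>
    3 * a2 = - (a3 * (x + y + z)) \<and> 3 * a1 = a3 * (x * y + y * z + z * x) \<and> a0 = - (a3 * (x * y * z))"
  by (auto simp: cubic_def algebra_simps)

text \<open>By Vieta, \<open>t\<close>, \<open>u\<close>, \<open>v\<close> are the roots of X^3 - 3
  A X + q. Eliminating \<open>v\<close>, \<open>A\<close> and \<open>q\<close> leaves a polynomial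
  identity in \<open>t\<close> and \<open>u\<close>.\<close>

lemma depressed_cubic_discriminant:
  fixes t u v A q :: real
  assumes "t + u + v = 0" "t * u + u * v + v * t = - (3 * A)" "t * u * v = - q"
  shows "27 * (4 * A ^ 3 - q\<^sup>2) = ((t - u) * (u - v) * (v - t))\<^sup>2"
proof -
  have v: "v = - t - u" using assms(1) by simp
  have "3 * A = t\<^sup>2 + t * u + u\<^sup>2" and q: "q = t * u * (t + u)"
    using assms by algebra+
  then have A: "A = (t\<^sup>2 + t * u + u\<^sup>2) / 3" by simp
  have "27 * 4 * A ^ 3 = 4 * (t\<^sup>2 + t * u + u\<^sup>2) ^ 3"
    unfolding A by (simp add: power_divide)
  then show ?thesis
    unfolding v q by (simp add: power2_eq_square power3_eq_cube algebra_simps)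
qed

lemma depressed_cubic_splits_iff:
  fixes A q :: real
  shows "(\<exists>t u v. t + u + v = 0 \<and> t * u + u * v + v * t = - (3 * A) \<and> t * u * v = - q) \<longleftrightarrow>
    A \<ge> 0 \<and> \<bar>q\<bar> \<le> 2 * sqrt A ^ 3"
proof safe
  fix t u v
  assume tuv: "t + u + v = 0" "t * u + u * v + v * t = - (3 * A)" "t * u * v = - q"
  have v: "v = - t - u" using tuv(1) by simp
  \<comment> \<open>Square \<open>t + u + v = 0\<close> and insert the second relation.\<close>
  have "6 * A = t\<^sup>2 + u\<^sup>2 + v\<^sup>2"
    using tuv(2) unfolding v by (simp add: power2_eq_square algebra_simps)
  then show A: "0 \<le> A"
    by (smt (verit) zero_le_power2)
  have "0 \<le> 27 * (4 * A ^ 3 - q\<^sup>2)"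
    using depressed_cubic_discriminant[OF tuv] by simp
  then have "q\<^sup>2 \<le> 4 * (sqrt A ^ 2) ^ 3" using A by simp
  also have "\<dots> = (2 * sqrt A ^ 3)\<^sup>2" by (simp add: power_mult_distrib flip: power_mult)
  finally have "\<bar>q\<bar> \<le> \<bar>2 * sqrt A ^ 3\<bar>"
    by (simp only: abs_le_square_iff)
  then show "\<bar>q\<bar> \<le> 2 * sqrt A ^ 3"
    using A by simp
next
  assume A: "0 \<le> A" and q: "\<bar>q\<bar> \<le> 2 * sqrt A ^ 3"
  define r where "r = sqrt A"
  have r: "0 \<le> r" "r\<^sup>2 = A" using A by (auto simp: r_def)
  let ?f = "\<lambda>t. t ^ 3 - 3 * A * t + q"
  \<comment> \<open>The two values are \<open>q - 2 * r ^ 3\<close> and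
    \<open>q + 2 * r ^ 3\<close>.\<close>
  have "?f (- 2 * r) \<le> 0" "0 \<le> ?f (2 * r)"
    using q r(1) by (simp_all add: r_def[symmetric] abs_le_iff r(2)[symmetric] power3_eq_cube power2_eq_square)
  moreover have "continuous_on {- 2 * r..2 * r} ?f" by (intro continuous_intros)
  ultimately obtain t where t: "- 2 * r \<le> t" "t \<le> 2 * r" "?f t = 0"
    using IVT'[of ?f "- 2 * r" 0 "2 * r"] r(1) by auto
  have "t\<^sup>2 \<le> (2 * r)\<^sup>2" using t by (intro power2_le_iff_abs_le[THEN iffD2]) auto
  then have disc: "0 \<le> 3 * (4 * A - t\<^sup>2)" using r(2) by (simp add: power_mult_distrib)
  define s where "s = sqrt (3 * (4 * A - t\<^sup>2))"
  have s: "s\<^sup>2 = 3 * (4 * A - t\<^sup>2)" unfolding s_def using disc by simp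
  \<comment> \<open>These are the roots of X^2 + t X + t^2 - 3 A, the quotient of the depressed
    cubic by X - t.\<close>
  let ?u = "(- t + s) / 2" and ?v = "(- t - s) / 2"
  have uv: "?u * ?v = t\<^sup>2 - 3 * A"
    using s by (simp add: power2_eq_square field_simps)
  have "t + ?u + ?v = 0" by (simp add: field_simps)
  moreover have "t * ?u + ?u * ?v + ?v * t = - (3 * A)"
    unfolding uv by (simp add: power2_eq_square field_simps)
  moreover have "t * ?u * ?v = - q"
    using t(3) unfolding mult.assoc uv by (simp add: power2_eq_square power3_eq_cube algebra_simps)
  ultimately show "\<exists>t u v. t + u + v = 0 \<and> t * u + u * v + v * t = - (3 * A) \<and> t * u * v = - q"
    by blast
qed

text \<open>Both sides amount to Vieta's relations, and the substitution x to
  \<open>a3 * x + a2\<close>, applied to each root, carries one system to the other.\<close>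

lemma cubic_splits_iff_depressed:
  fixes a0 a1 a2 a3 :: real
  assumes "a3 \<noteq> 0"
  defines "A \<equiv> quadratic_element a1 a2 a3"
  shows "(\<exists>x y z. cubic a0 a1 a2 a3 = smult a3 ([:-x, 1:] * [:-y, 1:] * [:-z, 1:])) \<longleftrightarrow>
    (\<exists>t u v. t + u + v = 0 \<and> t * u + u * v + v * t = - (3 * A) \<and>
       t * u * v = - (a0 * a3\<^sup>2 + 3 * a2 * A - a2 ^ 3))"
proof -
  let ?q = "a0 * a3\<^sup>2 + 3 * a2 * A - a2 ^ 3"
  let ?P = "\<lambda>t u v. t + u + v = 0 \<and> t * u + u * v + v * t = - (3 * A) \<and> t * u * v = - ?q"
  let ?Q = "\<lambda>x y z. 3 * a2 = - (a3 * (x + y + z)) \<and> 3 * a1 = a3 * (x * y + y * z + z * x) \<and>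
      a0 = - (a3 * (x * y * z))"
  have A: "A = a2\<^sup>2 - a1 * a3" by (simp add: A_def quadratic_element_def)
  have shift: "?P (a3 * x + a2) (a3 * y + a2) (a3 * z + a2) \<longleftrightarrow> ?Q x y z" for x y z
  proof
    assume "?Q x y z"
    then show "?P (a3 * x + a2) (a3 * y + a2) (a3 * z + a2)"
      unfolding A by algebra
  next
    assume P: "?P (a3 * x + a2) (a3 * y + a2) (a3 * z + a2)"
    have e1: "3 * a2 = - (a3 * (x + y + z))" using P by algebra
    \<comment> \<open>The shifted relations determine the pair sum only up to a factor
      \<open>a3\<close> and the product only up to \<open>a3\<^sup>2\<close>; both factors
      cancel.\<close>
    have "a3 * (3 * a1) = a3 * (a3 * (x * y + y * z + z * x))"
      using P e1 unfolding A by algebra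
    then have e2: "3 * a1 = a3 * (x * y + y * z + z * x)" using assms by simp
    have "a3\<^sup>2 * a0 = a3\<^sup>2 * - (a3 * (x * y * z))"
      using P e1 e2 unfolding A by algebra
    then have "a0 = - (a3 * (x * y * z))"
      using assms by (simp only: mult_cancel_left power_eq_0_iff) simp
    with e1 e2 show "?Q x y z" by blast
  qed
  \<comment> \<open>Every real is a shifted one, so any witnesses \<open>t\<close>,
    \<open>u\<close>, \<open>v\<close> come from some \<open>x\<close>, \<open>y\<close>,
    \<open>z\<close>.\<close>
  have unshift: "a3 * ((t - a2) / a3) + a2 = t" for t
    using assms by simp
  show ?thesis
    unfolding cubic_splits_iff using shift by (metis unshift)
qed

theorem theorem5:
  fixes a0 a1 a2 a3 :: real
  assumes "a3 \<noteq> 0"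
  shows "three_real_roots (cubic a0 a1 a2 a3) \<longleftrightarrow>
           quadratic_element a1 a2 a3 \<ge> 0 \<and>
           a0 \<in> {a0_lower a1 a2 a3..a0_upper a1 a2 a3}"
proof -
  define A where "A = quadratic_element a1 a2 a3"
  have cub: "degree (cubic a0 a1 a2 a3) = 3" "lead_coeff (cubic a0 a1 a2 a3) = a3"
    using assms by (simp_all add: cubic_def)
  have "three_real_roots (cubic a0 a1 a2 a3) \<longleftrightarrow>
      0 \<le> A \<and> \<bar>a0 * a3\<^sup>2 + 3 * a2 * A - a2 ^ 3\<bar> \<le> 2 * sqrt A ^ 3"
    unfolding three_real_roots_iff[OF cub(1)] cub(2) cubic_splits_iff_depressed[OF assms]
      depressed_cubic_splits_iff A_def ..
  \<comment> \<open>For \<open>0 \<le> A\<close> the two forms of the bound agree, including at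
    \<open>A = 0\<close>, where both vanish.\<close>
  also have "\<dots> \<longleftrightarrow> 0 \<le> A \<and> \<bar>a0 * a3\<^sup>2 + 3 * a2 * A - a2 ^ 3\<bar> \<le> 2 * A powr (3/2)"
    by (auto simp: powr_half_sqrt[symmetric] powr_powr simp flip: powr_numeral powr_realpow')
  also have "\<dots> \<longleftrightarrow> 0 \<le> A \<and> a0 \<in> {a0_lower a1 a2 a3..a0_upper a1 a2 a3}"
    using assms by (auto simp: a0_lower_def a0_upper_def A_def field_simps abs_le_iff)
  finally show ?thesis unfolding A_def .
qed

end
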